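(* Let $\mathbb{X},\mathbb{Y}$ be Euclidean spaces, $g:\mathbb{X}\to\mathbb{R}$ a continuous convex function, $\Phi:\mathbb{X}\to\mathbb{Y}$ a linear operator, and $K\subset\mathbb{Y}$ a closed convex polyhedral set. Consider the problem $$\min_{x\in\mathbb{X}}\ g(x)\quad\text{subject to}\quad \Phi x\in K .$$ Let $x_0$ be a stationary point of this problem, i.e. $\Phi x_0\in K$ and the set of Lagrange multipliers $$\Lambda(x_0):=\{\lambda\in N_K(\Phi x_0)\mid -\Phi^*\lambda\in\partial g(x_0)\}$$ is nonempty. Suppose that $g$ is second order regular at $x_0$ and satisfies the quadratic growth condition at $x_0$. Then $x_0$ is a strong solution of the problem if and only if $$\Big[\bigcap_{\lambda\in\Lambda(x_0)}T_{\partial g^*(-\Phi^*\lambda)}(x_0)\Big]\cap C(x_0)=\{0\},$$ where $C(x_0):=\{w\in\mathbb{X}\mid \Phi w\in T_K(\Phi x_0),\ dg(x_0)(w)=0\}$ is the critical cone.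
   Context: $x_0$ is a strong solution of the problem if there exist $\varepsilon,c>0$ with $g(x)-g(x_0)\ge c\|x-x_0\|^2$ for all $x\in\mathbb{B}_\varepsilon(x_0)$ with $\Phi x\in K$. $\partial g$ is the convex subdifferential, $g^*$ the Fenchel conjugate (so $\partial g^*(v)=(\partial g)^{-1}(v)$), and $dg(x_0)(w)=\liminf_{t\downarrow0,\,w'\to w}\frac{g(x_0+tw')-g(x_0)}{t}$. $N_K$ is the convex normal cone. The contingent cone to a closed set $\Omega$ at $\bar x\in \Omega$ is $T_\Omega(\bar x)=\{w\mid\exists\, t_k\downarrow0,\ w_k\to w,\ \bar x+t_kw_k\in \Omega\}$. Quadratic growth: $g$ satisfies the quadratic growth condition at $x_0$ if for every $\bar v\in\partial g(x_0)$ there exist $\varepsilon,\delta,\kappa>0$ such that $g(x)-g(x_0)-\langle\bar v,x-x_0\rangle\ge\frac{\kappa}{2}[\operatorname{dist}(x;S(x_0,\bar v))]^2$ for all $x\in\mathbb{B}_\varepsilon(x_0)$ with $g(x)-g(x_0)-\langle\bar v,x-x_0\rangle<\delta$, where $S(x_0,\bar v)=\{x\mid g(x)-\langle\bar v,x\rangle\le g(x_0)-\langle\bar v,x_0\rangle\}$ $(=\partial g^*(\bar v))$. Second order regularity: for a closed set $\Omega$, $\bar x\in\Omega$ and a direction $w$, let $T^{i,2}_\Omega(\bar x|w)=\{z\mid\forall\, t_k\downarrow0\ \exists\, z_k\to z:\ \bar x+t_kw+\tfrac12t_k^2z_k\in\Omega\}$ and $T^{2}_\Omega(\bar x|w)=\{z\mid\exists\,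 t_k\downarrow0,\ z_k\to z:\ \bar x+t_kw+\tfrac12t_k^2z_k\in\Omega\}$. The set $\Omega$ is second order regular at $\bar x$ if for every $w\in T_\Omega(\bar x)$ one has $T^2_\Omega(\bar x|w)=T^{i,2}_\Omega(\bar x|w)$ and, for every sequence $x_k\in\Omega$ of the form $x_k=\bar x+t_kw+\frac12t_k^2r_k$ with $t_k\downarrow0$ and $t_kr_k\to0$, $\lim_{k\to\infty}\operatorname{dist}(r_k;T^2_\Omega(\bar x|w))=0$. A function $g$ is second order regular at $x_0$ if its epigraph is second order regular at $(x_0,g(x_0))$. *)

theory Defs
  imports "HOL-Analysis.Analysis"
begin

text \<open>The convex subdifferential of an extended real valued function; it is empty at
  points where the function is not finite. A finite function \<open>g\<close> is embedded as
  \<open>\<lambda>x. ereal (g x)\<close>.\<close>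

definition subdifferential :: "('a::real_inner \<Rightarrow> ereal) \<Rightarrow> 'a \<Rightarrow> 'a set" where
  "subdifferential f x =
     {v. \<bar>f x\<bar> \<noteq> \<infinity> \<and> (\<forall>y. f x + ereal (v \<bullet> (y - x)) \<le> f y)}"

definition fenchel_conjugate :: "('a::real_inner \<Rightarrow> real) \<Rightarrow> 'a \<Rightarrow> ereal" where
  "fenchel_conjugate g v = (SUP x. ereal (v \<bullet> x - g x))"

text \<open>The filter \<open>nhds w\<close> is not punctured: \<open>w' = w\<close> is allowed in the lower limit.\<close>

definition subderivative ::
    "('a::real_normed_vector \<Rightarrow> real) \<Rightarrow> 'a \<Rightarrow> 'a \<Rightarrow> ereal" where
  "subderivative g x w =
     Liminf (at_right 0 \<times>\<^sub>F nhds w) (\<lambda>(t, w'). ereal ((g (x + t *\<^sub>R w') - g x) / t))"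

definition normal_cone :: "'a::real_inner set \<Rightarrow> 'a \<Rightarrow> 'a set" where
  "normal_cone K y = {v. y \<in> K \<and> (\<forall>z\<in>K. v \<bullet> (z - y) \<le> 0)}"

text \<open>The convention \<open>t\<^sub>k \<down> 0\<close>: positive and convergent to \<open>0\<close>, not necessarily monotone.\<close>

definition decreases_to_0 :: "(nat \<Rightarrow> real) \<Rightarrow> bool" where
  "decreases_to_0 t \<longleftrightarrow> (\<forall>k. 0 < t k) \<and> t \<longlonglongrightarrow> 0"

definition contingent_cone :: "'a::real_normed_vector set \<Rightarrow> 'a \<Rightarrow> 'a set" where
  "contingent_cone \<Omega> x =
     {w. \<exists>t u. decreases_to_0 t \<and> u \<longlonglongrightarrow> w \<and> (\<forall>k. x + t k *\<^sub>R u k \<in> \<Omega>)}"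

definition inner_second_tangent_set ::
    "'a::real_normed_vector set \<Rightarrow> 'a \<Rightarrow> 'a \<Rightarrow> 'a set" where
  "inner_second_tangent_set \<Omega> x w =
     {z. \<forall>t. decreases_to_0 t \<longrightarrow>
           (\<exists>u. u \<longlonglongrightarrow> z \<and> (\<forall>k. x + t k *\<^sub>R w + (1/2 * (t k)\<^sup>2) *\<^sub>R u k \<in> \<Omega>))}"

definition outer_second_tangent_set ::
    "'a::real_normed_vector set \<Rightarrow> 'a \<Rightarrow> 'a \<Rightarrow> 'a set" where
  "outer_second_tangent_set \<Omega> x w =
     {z. \<exists>t u. decreases_to_0 t \<and> u \<longlonglongrightarrow> z \<and>
           (\<forall>k. x + t k *\<^sub>R w + (1/2 * (t k)\<^sup>2) *\<^sub>R u k \<in> \<Omega>)}"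

text \<open>Unlike \<^const>\<open>infdist\<close>, the distance to the empty set is \<open>\<infinity>\<close>. This matters for second
  order regularity: the outer second order tangent set of a closed convex set can be empty
  in a contingent direction, and the set is then not second order regular.\<close>

definition ext_infdist :: "'a::metric_space \<Rightarrow> 'a set \<Rightarrow> ereal" where
  "ext_infdist x S = (INF a\<in>S. ereal (dist x a))"

definition second_order_regular_set :: "'a::real_normed_vector set \<Rightarrow> 'a \<Rightarrow> bool" where
  "second_order_regular_set \<Omega> x \<longleftrightarrow>
     (\<forall>w\<in>contingent_cone \<Omega> x.
        outer_second_tangent_set \<Omega> x w = inner_second_tangent_set \<Omega> x w \<and>
        (\<forall>t r. decreases_to_0 t \<longrightarrow> (\<lambda>k. t k *\<^sub>R r k) \<longlonglongrightarrow> 0 \<longrightarrow>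
           (\<forall>k. x + t k *\<^sub>R w + (1/2 * (t k)\<^sup>2) *\<^sub>R r k \<in> \<Omega>) \<longrightarrow>
           (\<lambda>k. ext_infdist (r k) (outer_second_tangent_set \<Omega> x w)) \<longlonglongrightarrow> 0))"

definition second_order_regular :: "('a::real_normed_vector \<Rightarrow> real) \<Rightarrow> 'a \<Rightarrow> bool" where
  "second_order_regular g x \<longleftrightarrow> second_order_regular_set (epigraph UNIV g) (x, g x)"

text \<open>The set \<open>{y. g y - v \<bullet> y \<le> g x - v \<bullet> x}\<close> contains \<open>x\<close>, so \<^const>\<open>infdist\<close> is the usual
  distance here.\<close>

definition quadratic_growth :: "('a::real_inner \<Rightarrow> real) \<Rightarrow> 'a \<Rightarrow> bool" where
  "quadratic_growth g x \<longleftrightarrow>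
     (\<forall>v\<in>subdifferential (\<lambda>y. ereal (g y)) x.
        \<exists>\<epsilon>>0. \<exists>\<delta>>0. \<exists>\<kappa>>0. \<forall>y\<in>cball x \<epsilon>.
          g y - g x - v \<bullet> (y - x) < \<delta> \<longrightarrow>
          \<kappa> / 2 * (infdist y {z. g z - v \<bullet> z \<le> g x - v \<bullet> x})\<^sup>2
            \<le> g y - g x - v \<bullet> (y - x))"

text \<open>The problem of minimizing \<open>g x\<close> subject to \<open>\<Phi> x \<in> K\<close>.\<close>

definition strong_solution ::
    "('a::real_normed_vector \<Rightarrow> real) \<Rightarrow> ('a \<Rightarrow> 'b) \<Rightarrow> 'b set \<Rightarrow> 'a \<Rightarrow> bool" where
  "strong_solution g \<Phi> K x \<longleftrightarrow>
     (\<exists>\<epsilon>>0. \<exists>c>0. \<forall>y\<in>cball x \<epsilon>. \<Phi> y \<in> K \<longrightarrow> g y - g x \<ge> c * (norm (y - x))\<^sup>2)"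

definition lagrange_multipliers ::
    "('a::real_inner \<Rightarrow> real) \<Rightarrow> ('a \<Rightarrow> 'b::real_inner) \<Rightarrow> 'b set \<Rightarrow> 'a \<Rightarrow> 'b set" where
  "lagrange_multipliers g \<Phi> K x =
     {\<mu> \<in> normal_cone K (\<Phi> x). - adjoint \<Phi> \<mu> \<in> subdifferential (\<lambda>y. ereal (g y)) x}"

definition stationary_point ::
    "('a::real_inner \<Rightarrow> real) \<Rightarrow> ('a \<Rightarrow> 'b::real_inner) \<Rightarrow> 'b set \<Rightarrow> 'a \<Rightarrow> bool" where
  "stationary_point g \<Phi> K x \<longleftrightarrow> \<Phi> x \<in> K \<and> lagrange_multipliers g \<Phi> K x \<noteq> {}"

definition critical_cone ::
    "('a::real_normed_vector \<Rightarrow> real) \<Rightarrow> ('a \<Rightarrow> 'b::real_normed_vector) \<Rightarrow> 'b set \<Rightarrow> 'a \<Rightarrow> 'a set" where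
  "critical_cone g \<Phi> K x =
     {w. \<Phi> w \<in> contingent_cone K (\<Phi> x) \<and> subderivative g x w = 0}"

end

theory Submission
  imports Defs
begin

text \<open>
  Sufficiency: if \<open>x\<^sub>0\<close> is not a strong solution, normalised differences of violating feasible
  points converge to a critical direction \<open>w \<noteq> 0\<close>. For each multiplier \<open>\<mu>\<close>, quadratic growth bounds
  the distance of these points to \<open>S = \<partial>g\<^sup>*(-\<Phi>\<^sup>*\<mu>)\<close> by \<open>o(t\<^sub>k)\<close>, so \<open>w\<close> is tangent to \<open>S\<close>.

  Necessity: let \<open>w \<noteq> 0\<close> lie in the intersection and let \<open>T\<close> be the second order tangent set of the
  epigraph in direction \<open>(w, 0)\<close>; regularity makes it nonempty and convex. Along the parabolas
  \<open>x\<^sub>0 + t w + t\<^sup>2 z / 2\<close>, feasible since \<open>K\<close> is polyhedral, the strong growth gives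
  \<open>r \<ge> m := 2 c \<parallel>w\<parallel>\<^sup>2\<close> for all \<open>(z, r) \<in> T\<close> with \<open>z\<close> in a polyhedral cone. Separation and Farkas' lemma
  turn this into one multiplier \<open>\<mu>\<close> with \<open>r \<ge> \<langle>-\<Phi>\<^sup>*\<mu>, z\<rangle> + m\<close> on the whole of \<open>T\<close>. But \<open>w\<close> is tangent
  to \<open>\<partial>g\<^sup>*(-\<Phi>\<^sup>*\<mu>)\<close>, where \<open>g\<close> is affine with slope \<open>-\<Phi>\<^sup>*\<mu>\<close>; by second order regularity some
  points of \<open>T\<close> then come arbitrarily close to the graph \<open>r = \<langle>-\<Phi>\<^sup>*\<mu>, z\<rangle>\<close>, a contradiction.
\<close>

section \<open>Separation and basic convex analysis\<close>

text \<open>The points below height \<open>m\<close> over \<open>P\<close> miss \<open>E\<close>, so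
  a hyperplane separates the two sets. As \<open>E\<close> projects onto the whole space, this
  hyperplane is not vertical and is the graph of an affine function.\<close>

lemma convex_minorant_separation:
  fixes E :: "('a::euclidean_space \<times> real) set"
  assumes "convex E" and proj: "fst ` E = UNIV" and "convex P" "P \<noteq> {}"
    and above: "\<And>z r. z \<in> P \<Longrightarrow> (z, r) \<in> E \<Longrightarrow> m \<le> r"
  obtains v \<beta> where "\<And>z r. (z, r) \<in> E \<Longrightarrow> v \<bullet> z + \<beta> \<le> r"
    and "\<And>z. z \<in> P \<Longrightarrow> m \<le> v \<bullet> z + \<beta>"
proof -
  have "convex (P \<times> {..<m})" "P \<times> {..<m} \<noteq> {}" "(P \<times> {..<m}) \<inter> E = {}" "E \<noteq> {}"
    using assms by (auto intro!: convex_Times, fastforce+)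
  then obtain a b where "a \<noteq> 0" and *: "\<forall>x\<in>P \<times> {..<m}. a \<bullet> x \<le> b" "\<forall>x\<in>E. b \<le> a \<bullet> x"
    using separating_hyperplane_sets[of "P \<times> {..<m}" E] \<open>convex E\<close> by blast
  obtain c \<alpha> where a: "a = (c, \<alpha>)" by (cases a)
  have le: "c \<bullet> z + \<alpha> * r \<le> b" if "z \<in> P" "r < m" for z r
    using that *(1) a by fastforce
  have ge: "b \<le> c \<bullet> z + \<alpha> * r" if "(z, r) \<in> E" for z r
    using that *(2) a by fastforce
  have ex: "\<exists>r. (z, r) \<in> E" for z
  proof -
    have "z \<in> fst ` E" using proj by simp
    then show ?thesis by force
  qed
  obtain z0 where z0: "z0 \<in> P" using \<open>P \<noteq> {}\<close> by blast
  obtain r0 where r0: "(z0, r0) \<in> E" using ex by blast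
  have "0 \<le> \<alpha> * (r0 - (m - 1))"
    using le[OF z0, of "m - 1"] ge[OF r0] by (simp add: algebra_simps)
  moreover have "0 < r0 - (m - 1)" using above[OF z0 r0] by simp
  ultimately have "0 \<le> \<alpha>" by (metis mult_neg_pos not_le)
  \<comment> \<open>If \<open>\<alpha> = 0\<close>, then \<open>c\<close> alone separates. Moving
    from \<open>z0\<close> by \<open>- c\<close> lowers it by \<open>c \<bullet> c\<close>, which
    forces \<open>c = 0\<close> and so \<open>a = 0\<close>.\<close>
  moreover have "\<alpha> \<noteq> 0"
  proof
    assume \<alpha>: "\<alpha> = 0"
    obtain r where "(z0 - c, r) \<in> E" using ex by blast
    from ge[OF this] le[OF z0, of "m - 1"] \<alpha> have "c \<bullet> c \<le> 0" by (simp add: inner_diff_right)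
    then have "c = 0" by (metis inner_gt_zero_iff not_less)
    then show False using \<open>a \<noteq> 0\<close> a \<alpha> by (simp add: zero_prod_def)
  qed
  ultimately have pos: "0 < \<alpha>" by simp
  show thesis
  proof (rule that[of "- c /\<^sub>R \<alpha>" "b / \<alpha>"])
    fix z r assume "(z, r) \<in> E"
    from ge[OF this] pos show "(- c /\<^sub>R \<alpha>) \<bullet> z + b / \<alpha> \<le> r"
      by (simp add: field_simps)
  next
    fix z assume z: "z \<in> P"
    show "m \<le> (- c /\<^sub>R \<alpha>) \<bullet> z + b / \<alpha>"
    \<comment> \<open>The separated set is open at the top: the bound is known for
      \<open>r < m\<close> only.\<close>
    proof (rule dense_le)
      fix r assume "r < m"
      from le[OF z this] pos show "r \<le> (- c /\<^sub>R \<alpha>) \<bullet> z + b / \<alpha>"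
        by (simp add: field_simps)
    qed
  qed
qed

lemma fst_epigraph_UNIV: "fst ` epigraph UNIV g = UNIV"
  by (force simp: epigraph_def image_iff)

lemma mem_subdifferential_ereal:
  "v \<in> subdifferential (\<lambda>y. ereal (g y)) x \<longleftrightarrow> (\<forall>y. g x + v \<bullet> (y - x) \<le> g y)"
  by (simp add: subdifferential_def)

text \<open>Separation with \<open>P = {x}\<close> gives an affine function below \<open>g\<close>
  that touches it at \<open>x\<close>.\<close>

lemma convex_on_subdifferential_nonempty:
  fixes g :: "'a::euclidean_space \<Rightarrow> real"
  assumes "convex_on UNIV g"
  shows "subdifferential (\<lambda>y. ereal (g y)) x \<noteq> {}"
proof -
  obtain v \<beta> where v: "\<And>z r. (z, r) \<in> epigraph UNIV g \<Longrightarrow> v \<bullet> z + \<beta> \<le> r"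
    and x: "\<And>z. z \<in> {x} \<Longrightarrow> g x \<le> v \<bullet> z + \<beta>"
    by (rule convex_minorant_separation[of "epigraph UNIV g" "{x}" "g x"])
      (auto simp: fst_epigraph_UNIV mem_epigraph intro: convex_epigraphI assms)
  have "g x + v \<bullet> (y - x) \<le> g y" for y
    using v[of y "g y"] x by (simp add: mem_epigraph inner_diff_right)
  then have "v \<in> subdifferential (\<lambda>y. ereal (g y)) x" by (simp add: mem_subdifferential_ereal)
  then show ?thesis by blast
qed

text \<open>The Fenchel-Young equality turns the subgradient inequality of the conjugate into one
  between values of \<open>g\<close>, and so yields the sublevel set used in
  \<open>quadratic_growth\<close>.\<close>

lemma subdifferential_fenchel_conjugate:
  fixes g :: "'a::euclidean_space \<Rightarrow> real"
  assumes "convex_on UNIV g" and v: "v \<in> subdifferential (\<lambda>y. ereal (g y)) x"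
  shows "subdifferential (fenchel_conjugate g) v = {z. g z - v \<bullet> z \<le> g x - v \<bullet> x}"
proof -
  have attained: "fenchel_conjugate g p = ereal (p \<bullet> u - g u)"
    if "p \<in> subdifferential (\<lambda>y. ereal (g y)) u" for p u
    unfolding fenchel_conjugate_def
  proof (rule antisym)
    show "(SUP y. ereal (p \<bullet> y - g y)) \<le> ereal (p \<bullet> u - g u)"
    proof (rule SUP_least)
      fix y
      have "g u + p \<bullet> (y - u) \<le> g y" using that by (simp add: mem_subdifferential_ereal)
      then show "ereal (p \<bullet> y - g y) \<le> ereal (p \<bullet> u - g u)" by (simp add: inner_diff_right)
    qed
  qed (auto intro: SUP_upper)
  have young: "ereal (p \<bullet> u - g u) \<le> fenchel_conjugate g p" for p u
    unfolding fenchel_conjugate_def by (auto intro: SUP_upper)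
  show ?thesis
  proof (intro equalityI subsetI CollectI)
    fix z assume z: "z \<in> subdifferential (fenchel_conjugate g) v"
    \<comment> \<open>The inequality is tested at a subgradient \<open>p\<close> at
      \<open>z\<close>, because there the conjugate is attained by \<open>z\<close> itself and
      \<open>p \<bullet> z\<close> cancels.\<close>
    obtain p where p: "p \<in> subdifferential (\<lambda>y. ereal (g y)) z"
      using convex_on_subdifferential_nonempty[OF assms(1)] by blast
    have "fenchel_conjugate g v + ereal (z \<bullet> (p - v)) \<le> fenchel_conjugate g p"
      using z by (simp add: subdifferential_def)
    then show "g z - v \<bullet> z \<le> g x - v \<bullet> x"
      unfolding attained[OF v] attained[OF p] by (simp add: inner_diff_right inner_commute)
  next
    fix z assume "z \<in> {z. g z - v \<bullet> z \<le> g x - v \<bullet> x}"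
    then have z: "g z - v \<bullet> z \<le> g x - v \<bullet> x" by simp
    have "fenchel_conjugate g v + ereal (z \<bullet> (p - v)) \<le> fenchel_conjugate g p" for p
    proof -
      have "fenchel_conjugate g v + ereal (z \<bullet> (p - v)) \<le> ereal (p \<bullet> z - g z)"
        unfolding attained[OF v] using z by (simp add: inner_diff_right inner_commute)
      also have "\<dots> \<le> fenchel_conjugate g p" by (rule young)
      finally show ?thesis .
    qed
    then show "z \<in> subdifferential (fenchel_conjugate g) v"
      by (simp add: subdifferential_def attained[OF v])
  qed
qed

text \<open>The segment from \<open>z\<close> to \<open>y\<close>, prolonged by unit length to
  \<open>u\<close>, stays in the ball of radius 2, where \<open>g\<close> is bounded by
  \<open>M\<close>. By convexity its slope is at most that from \<open>z\<close> to
  \<open>u\<close>, whose length exceeds 1.\<close>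

lemma convex_on_locally_lipschitz:
  fixes g :: "'a::euclidean_space \<Rightarrow> real"
  assumes conv: "convex_on UNIV g" and cont: "continuous_on UNIV g"
  obtains L where "\<And>y z. y \<in> cball x 1 \<Longrightarrow> z \<in> cball x 1 \<Longrightarrow> g y - g z \<le> L * norm (y - z)"
proof -
  have "compact (g ` cball x 2)"
    by (intro compact_continuous_image continuous_on_subset[OF cont]) auto
  then obtain M where M: "\<And>y. y \<in> cball x 2 \<Longrightarrow> \<bar>g y\<bar> \<le> M"
    using compact_imp_bounded bounded_iff by (metis image_eqI real_norm_def)
  show thesis
  proof (rule that[of "2 * M"])
    fix y z assume y: "y \<in> cball x 1" and z: "z \<in> cball x 1"
    show "g y - g z \<le> 2 * M * norm (y - z)"
    proof (cases "y = z")
      case False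
      define d where "d = norm (y - z)"
      define u where "u = y + (y - z) /\<^sub>R d"
      have d: "d > 0" using False by (simp add: d_def)
      have "dist x u \<le> dist x y + dist y u" by (rule dist_triangle)
      also have "dist y u = 1" using d by (simp add: u_def dist_norm d_def)
      finally have u: "u \<in> cball x 2" using y by simp
      have "y = (1 - d / (1 + d)) *\<^sub>R z + (d / (1 + d)) *\<^sub>R u"
      proof -
        have "(1 + d) *\<^sub>R ((1 - d / (1 + d)) *\<^sub>R z + (d / (1 + d)) *\<^sub>R u) = z + d *\<^sub>R u"
          using d by (simp add: scaleR_add_right add_pos_pos field_simps)
        also have "\<dots> = (1 + d) *\<^sub>R y"
          using d by (simp add: u_def algebra_simps)
        finally show ?thesis using d by simp
      qed
      then have "g y \<le> (1 - d / (1 + d)) * g z + (d / (1 + d)) * g u"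
        using convex_onD[OF conv, of "d / (1 + d)" z u] d by simp
      then have "g y - g z \<le> (d / (1 + d)) * (g u - g z)"
        by (simp add: algebra_simps diff_divide_distrib)
      also have "\<dots> \<le> (d / (1 + d)) * (2 * M)"
        using M[OF u] M[of z] z d by (intro mult_left_mono) auto
      also have "\<dots> \<le> d * (2 * M)"
        using M[OF u] d by (intro mult_right_mono) (auto simp: field_simps)
      finally show ?thesis by (simp add: d_def mult.commute)
    qed simp
  qed
qed

section \<open>Farkas' lemma and first order tangency\<close>

text \<open>A finitely generated cone is closed. Were \<open>d\<close> outside it, the negated
  normal of a strictly separating hyperplane would violate \<open>imp\<close>.\<close>

lemma adjoint_farkas:
  fixes \<Phi> :: "'a::euclidean_space \<Rightarrow> 'b::euclidean_space"
  assumes lin: "linear \<Phi>" and fin: "finite J"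
    and imp: "\<And>z. (\<And>a. a \<in> J \<Longrightarrow> a \<bullet> \<Phi> z \<le> 0) \<Longrightarrow> d \<bullet> z \<le> 0"
  obtains \<mu> where "\<mu> \<in> convex_cone hull J" "d = adjoint \<Phi> \<mu>"
proof -
  let ?C = "convex_cone hull (adjoint \<Phi> ` J)"
  have C: "?C = adjoint \<Phi> ` (convex_cone hull J)"
    by (rule convex_cone_hull_linear_image[OF adjoint_linear[OF lin]])
  have "d \<in> ?C"
  proof (rule ccontr)
    assume "d \<notin> ?C"
    then obtain a b where ab: "a \<bullet> d < b" "\<forall>x\<in>?C. b < a \<bullet> x"
      using separating_hyperplane_closed_point[of ?C d] fin
      by (meson closed_convex_cone_hull convex_convex_cone_hull finite_imageI)
    have "b < 0" using ab(2) convex_cone_hull_contains_0 by force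
    \<comment> \<open>A cone point with a negative value could be scaled to the level
      \<open>b\<close> exactly, but the cone lies strictly above \<open>b\<close>.\<close>
    have nonneg: "0 \<le> a \<bullet> x" if "x \<in> ?C" for x
    proof (rule ccontr)
      assume neg: "\<not> 0 \<le> a \<bullet> x"
      then have "(b / (a \<bullet> x)) *\<^sub>R x \<in> ?C"
        using \<open>b < 0\<close> that by (intro convex_cone_hull_mul) (auto intro!: divide_nonpos_neg)
      with ab(2) have "b < a \<bullet> ((b / (a \<bullet> x)) *\<^sub>R x)" by blast
      then show False using neg by simp
    qed
    have "d \<bullet> (- a) \<le> 0"
    proof (rule imp)
      fix j assume "j \<in> J"
      then have "0 \<le> a \<bullet> adjoint \<Phi> j" by (intro nonneg hull_inc) simp
      then show "j \<bullet> \<Phi> (- a) \<le> 0"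
        using lin by (simp add: linear_neg adjoint_works[OF lin] inner_commute)
    qed
    then show False using ab(1) \<open>b < 0\<close> by (simp add: inner_commute)
  qed
  then show thesis using C that by auto
qed

lemma normal_cone_contingent_cone:
  assumes "p \<in> normal_cone K y" "d \<in> contingent_cone K y"
  shows "p \<bullet> d \<le> 0"
proof -
  obtain t u where t: "decreases_to_0 t" and u: "u \<longlonglongrightarrow> d" and K: "\<And>k. y + t k *\<^sub>R u k \<in> K"
    using assms(2) by (auto simp: contingent_cone_def)
  have "p \<bullet> u k \<le> 0" for k
  proof -
    have "p \<bullet> (y + t k *\<^sub>R u k - y) \<le> 0"
      using assms(1) K[of k] unfolding normal_cone_def by blast
    then have "t k * (p \<bullet> u k) \<le> 0" by simp
    moreover have "0 < t k" using t by (simp add: decreases_to_0_def)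
    ultimately show ?thesis by (simp add: mult_le_0_iff)
  qed
  moreover have "(\<lambda>k. p \<bullet> u k) \<longlonglongrightarrow> p \<bullet> d" by (intro tendsto_intros u)
  ultimately show ?thesis by (meson LIMSEQ_le_const2)
qed

text \<open>Combined with the subgradient bound on the subderivative, this sign makes the
  subderivative nonnegative, and for critical \<open>w\<close> it forces the inner product to be
  0.\<close>

lemma multiplier_contingent_nonneg:
  fixes \<Phi> :: "'a::euclidean_space \<Rightarrow> 'b::euclidean_space"
  assumes "linear \<Phi>" "\<mu> \<in> lagrange_multipliers g \<Phi> K x" "\<Phi> w \<in> contingent_cone K (\<Phi> x)"
  shows "0 \<le> (- adjoint \<Phi> \<mu>) \<bullet> w"
  using normal_cone_contingent_cone[of \<mu> K "\<Phi> x" "\<Phi> w"] assms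
  by (simp add: lagrange_multipliers_def adjoint_works inner_commute)

text \<open>Each difference quotient is at least \<open>v \<bullet> w'\<close>, which converges to
  \<open>v \<bullet> w\<close>.\<close>

lemma subderivative_ge_subgradient:
  fixes g :: "'a::euclidean_space \<Rightarrow> real"
  assumes v: "v \<in> subdifferential (\<lambda>y. ereal (g y)) x"
  shows "ereal (v \<bullet> w) \<le> subderivative g x w"
proof -
  have "ereal (v \<bullet> w) = Liminf (at_right (0::real) \<times>\<^sub>F nhds w) (\<lambda>(t, w'). ereal (v \<bullet> w'))"
  proof (rule lim_imp_Liminf[symmetric])
    show "at_right (0::real) \<times>\<^sub>F nhds w \<noteq> bot" by (simp add: prod_filter_eq_bot)
    have "filterlim snd (nhds w) (at_right (0::real) \<times>\<^sub>F nhds w)" by (rule filterlim_snd)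
    then show "((\<lambda>(t, w'). ereal (v \<bullet> w')) \<longlongrightarrow> ereal (v \<bullet> w)) (at_right (0::real) \<times>\<^sub>F nhds w)"
      by (auto simp: case_prod_unfold intro!: tendsto_intros)
  qed
  also have "\<dots> \<le> subderivative g x w"
    unfolding subderivative_def
  proof (rule Liminf_mono)
    have "filterlim fst (at_right 0) (at_right (0::real) \<times>\<^sub>F nhds w)" by (rule filterlim_fst)
    then have "\<forall>\<^sub>F p in at_right (0::real) \<times>\<^sub>F nhds w. 0 < fst p"
      using eventually_at_right_less[of "0::real"] by (simp add: filterlim_iff)
    then show "\<forall>\<^sub>F p in at_right 0 \<times>\<^sub>F nhds w. (case p of (t, w') \<Rightarrow> ereal (v \<bullet> w'))
        \<le> (case p of (t, w') \<Rightarrow> ereal ((g (x + t *\<^sub>R w') - g x) / t))"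
    proof eventually_elim
      case (elim p)
      obtain t w' where p: "p = (t, w')" by (cases p)
      have "g x + v \<bullet> (x + t *\<^sub>R w' - x) \<le> g (x + t *\<^sub>R w')"
        using v unfolding mem_subdifferential_ereal by blast
      then show ?case using elim by (simp add: p field_simps)
    qed
  qed
  finally show ?thesis .
qed

lemma subderivative_le_sequence:
  assumes t: "decreases_to_0 t" and u: "u \<longlonglongrightarrow> w"
    and q: "\<And>k. (g (x + t k *\<^sub>R u k) - g x) / t k \<le> q k" and l: "q \<longlonglongrightarrow> l"
  shows "subderivative g x w \<le> ereal l"
proof -
  have "filterlim t (at_right 0) sequentially"
    using t by (auto simp: decreases_to_0_def filterlim_at intro!: always_eventually less_imp_neq[symmetric])
  then have lim: "filterlim (\<lambda>k. (t k, u k)) (at_right 0 \<times>\<^sub>F nhds w) sequentially"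
    using u by (rule filterlim_Pair)
  let ?f = "\<lambda>(t, w'). ereal ((g (x + t *\<^sub>R w') - g x) / t)"
  have "y \<le> ereal l" if "y < subderivative g x w" for y
  proof -
    have "\<forall>\<^sub>F p in at_right 0 \<times>\<^sub>F nhds w. y < ?f p"
      using that unfolding subderivative_def by (rule less_LiminfD)
    then have "\<forall>\<^sub>F k in sequentially. y < ?f (t k, u k)"
      using lim by (rule eventually_compose_filterlim)
    then have "\<forall>\<^sub>F k in sequentially. y \<le> ereal (q k)"
      by eventually_elim (use q in \<open>auto intro: order.trans[OF less_imp_le]\<close>)
    then show ?thesis
      by (intro tendsto_lowerbound[of "\<lambda>k. ereal (q k)"]) (auto intro: l)
  qed
  then show ?thesis by (rule dense_le)
qed

section \<open>Second order tangent sets of convex sets\<close>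

lemma decreases_to_0D: "decreases_to_0 t \<Longrightarrow> 0 < t k" "decreases_to_0 t \<Longrightarrow> t \<longlonglongrightarrow> 0"
  by (auto simp: decreases_to_0_def)

lemma decreases_to_0_inverse_Suc: "decreases_to_0 (\<lambda>k. inverse (real (Suc k)))"
  using LIMSEQ_inverse_real_of_nat by (simp add: decreases_to_0_def)

text \<open>Inner tangency holds along every \<open>t\<close>, so both points are realised with the
  same step sizes and can be averaged. In the outer set the step sizes might differ; regularity
  later identifies the two sets.\<close>

lemma convex_inner_second_tangent_set:
  assumes "convex \<Omega>"
  shows "convex (inner_second_tangent_set \<Omega> x w)"
proof (rule convexI)
  fix y z and a b :: real
  assume y: "y \<in> inner_second_tangent_set \<Omega> x w" and z: "z \<in> inner_second_tangent_set \<Omega> x w"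
    and ab: "0 \<le> a" "0 \<le> b" "a + b = 1"
  show "a *\<^sub>R y + b *\<^sub>R z \<in> inner_second_tangent_set \<Omega> x w"
    unfolding inner_second_tangent_set_def
  proof (intro CollectI allI impI)
    fix t assume t: "decreases_to_0 t"
    obtain u1 where u1: "u1 \<longlonglongrightarrow> y" "\<And>k. x + t k *\<^sub>R w + (1/2 * (t k)\<^sup>2) *\<^sub>R u1 k \<in> \<Omega>"
      using y t by (auto simp: inner_second_tangent_set_def)
    obtain u2 where u2: "u2 \<longlonglongrightarrow> z" "\<And>k. x + t k *\<^sub>R w + (1/2 * (t k)\<^sup>2) *\<^sub>R u2 k \<in> \<Omega>"
      using z t by (auto simp: inner_second_tangent_set_def)
    have "x + t k *\<^sub>R w + (1/2 * (t k)\<^sup>2) *\<^sub>R (a *\<^sub>R u1 k + b *\<^sub>R u2 k) \<in> \<Omega>" for k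
    proof -
      have "p + e *\<^sub>R (a *\<^sub>R p1 + b *\<^sub>R p2) = a *\<^sub>R (p + e *\<^sub>R p1) + b *\<^sub>R (p + e *\<^sub>R p2)"
        for p p1 p2 :: 'a and e
      proof -
        have "a *\<^sub>R (p + e *\<^sub>R p1) + b *\<^sub>R (p + e *\<^sub>R p2)
            = (a + b) *\<^sub>R p + e *\<^sub>R (a *\<^sub>R p1 + b *\<^sub>R p2)"
          by (simp add: algebra_simps)
        then show ?thesis using ab by simp
      qed
      then have "x + t k *\<^sub>R w + (1/2 * (t k)\<^sup>2) *\<^sub>R (a *\<^sub>R u1 k + b *\<^sub>R u2 k)
          = a *\<^sub>R (x + t k *\<^sub>R w + (1/2 * (t k)\<^sup>2) *\<^sub>R u1 k) + b *\<^sub>R (x + t k *\<^sub>R w + (1/2 * (t k)\<^sup>2) *\<^sub>R u2 k)"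
        .
      then show ?thesis
        using convexD[OF assms u1(2) u2(2) ab, of k k] by simp
    qed
    moreover have "(\<lambda>k. a *\<^sub>R u1 k + b *\<^sub>R u2 k) \<longlonglongrightarrow> a *\<^sub>R y + b *\<^sub>R z"
      by (intro tendsto_intros u1 u2)
    ultimately show "\<exists>u. u \<longlonglongrightarrow> a *\<^sub>R y + b *\<^sub>R z \<and> (\<forall>k. x + t k *\<^sub>R w + (1/2 * (t k)\<^sup>2) *\<^sub>R u k \<in> \<Omega>)"
      by blast
  qed
qed

text \<open>A move of order \<open>t^2\<close> towards a point of the convex set only affects the
  second order term. For the epigraph, the resulting recession directions give the full projection
  and the subgradient inequality.\<close>

lemma inner_second_tangent_set_recession:
  assumes conv: "convex \<Omega>" and d: "x + d \<in> \<Omega>" and s: "0 \<le> s"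
    and z: "z \<in> inner_second_tangent_set \<Omega> x w"
  shows "z + s *\<^sub>R d \<in> inner_second_tangent_set \<Omega> x w"
  unfolding inner_second_tangent_set_def
proof (intro CollectI allI impI)
  fix t assume t: "decreases_to_0 t"
  \<comment> \<open>The weight is chosen so that \<open>\<alpha> k\<close> times \<open>d\<close> is
    the desired shift \<open>s d\<close> at second order scale.\<close>
  define \<alpha> where "\<alpha> k = (t k)\<^sup>2 * s / 2" for k
  have \<alpha>0: "\<alpha> \<longlonglongrightarrow> 0"
    unfolding \<alpha>_def by (rule tendsto_eq_intros decreases_to_0D(2)[OF t] | simp)+
  have \<alpha>nn: "0 \<le> \<alpha> k" for k using s by (simp add: \<alpha>_def)
  define t' where "t' k = (if \<alpha> k < 1 then t k / (1 - \<alpha> k) else t k)" for k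
  have ev: "\<forall>\<^sub>F k in sequentially. \<alpha> k < 1" using \<alpha>0 by (rule order_tendstoD) simp
  have "(\<lambda>k. t k / (1 - \<alpha> k)) \<longlonglongrightarrow> 0 / (1 - 0)"
    by (intro tendsto_intros \<alpha>0 decreases_to_0D(2)[OF t]) simp
  then have "t' \<longlonglongrightarrow> 0 / (1 - 0)"
    by (rule Lim_transform_eventually) (use ev in \<open>auto elim!: eventually_mono simp: t'_def\<close>)
  then have t': "decreases_to_0 t'"
    using decreases_to_0D(1)[OF t] by (auto simp: decreases_to_0_def t'_def)
  \<comment> \<open>Averaging the points for \<open>t'\<close> with \<open>x + d\<close> in weights \<open>1 - \<alpha>\<close>, \<open>\<alpha>\<close> restores the first order
    term \<open>t w\<close> exactly.\<close>
  obtain u where u: "u \<longlonglongrightarrow> z" "\<And>k. x + t' k *\<^sub>R w + (1/2 * (t' k)\<^sup>2) *\<^sub>R u k \<in> \<Omega>"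
    using z t' by (auto simp: inner_second_tangent_set_def)
  \<comment> \<open>Only finitely many indices have \<open>\<alpha> k \<ge> 1\<close>. There
    \<open>t'\<close> falls back to \<open>t\<close>, and \<open>u0\<close> keeps the points in the
    set.\<close>
  obtain u0 where u0: "\<And>k. x + t k *\<^sub>R w + (1/2 * (t k)\<^sup>2) *\<^sub>R u0 k \<in> \<Omega>"
    using z t by (auto simp: inner_second_tangent_set_def)
  define y where "y k = (if \<alpha> k < 1 then u k /\<^sub>R (1 - \<alpha> k) + s *\<^sub>R d else u0 k)" for k
  have "(\<lambda>k. u k /\<^sub>R (1 - \<alpha> k) + s *\<^sub>R d) \<longlonglongrightarrow> z /\<^sub>R (1 - 0) + s *\<^sub>R d"
    by (intro tendsto_intros \<alpha>0 u) simp
  then have "y \<longlonglongrightarrow> z /\<^sub>R (1 - 0) + s *\<^sub>R d"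
    by (rule Lim_transform_eventually) (use ev in \<open>auto elim!: eventually_mono simp: y_def\<close>)
  moreover have "x + t k *\<^sub>R w + (1/2 * (t k)\<^sup>2) *\<^sub>R y k \<in> \<Omega>" for k
  proof (cases "\<alpha> k < 1")
    case True
    define b where "b = 1 - \<alpha> k"
    have b: "b > 0" using True by (simp add: b_def)
    have "b *\<^sub>R (x + t' k *\<^sub>R w + (1/2 * (t' k)\<^sup>2) *\<^sub>R u k) + \<alpha> k *\<^sub>R (x + d) \<in> \<Omega>"
      using \<alpha>nn[of k] b by (intro convexD[OF conv u(2) d]) (auto simp: b_def)
    moreover have "b *\<^sub>R (x + t' k *\<^sub>R w + (1/2 * (t' k)\<^sup>2) *\<^sub>R u k) + \<alpha> k *\<^sub>R (x + d)
        = (b + \<alpha> k) *\<^sub>R x + t k *\<^sub>R w + (1/2 * (t k)\<^sup>2 / b) *\<^sub>R u k + \<alpha> k *\<^sub>R d"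
      using True b by (simp add: t'_def scaleR_add_right scaleR_add_left power2_eq_square flip: b_def)
    moreover have "(1/2 * (t k)\<^sup>2) *\<^sub>R y k = (1/2 * (t k)\<^sup>2 / b) *\<^sub>R u k + \<alpha> k *\<^sub>R d"
      using True by (simp add: y_def \<alpha>_def b_def scaleR_add_right field_simps)
    ultimately show ?thesis by (simp add: b_def add.assoc)
  next
    case False
    then show ?thesis using u0 by (simp add: y_def)
  qed
  ultimately show "\<exists>u. u \<longlonglongrightarrow> z + s *\<^sub>R d \<and> (\<forall>k. x + t k *\<^sub>R w + (1/2 * (t k)\<^sup>2) *\<^sub>R u k \<in> \<Omega>)"
    by auto
qed

section \<open>Necessity of the tangent cone condition\<close>

text \<open>One affine minorant of the second order set does everything: being bounded below on the
  cone \<open>P\<close>, it has a slope given by a normal vector (Farkas); its recession behaviour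
  makes the slope a subgradient; its offset is at least \<open>m\<close>.\<close>

lemma second_tangent_multiplier:
  fixes g :: "'a::euclidean_space \<Rightarrow> real" and \<Phi> :: "'a \<Rightarrow> 'b::euclidean_space"
  assumes cont: "continuous_on UNIV g" and conv: "convex_on UNIV g"
    and lin: "linear \<Phi>" and poly: "polyhedron K" and feas: "\<Phi> x \<in> K"
    and strong: "strong_solution g \<Phi> K x" and w: "\<Phi> w \<in> contingent_cone K (\<Phi> x)" "w \<noteq> 0"
    and ne: "inner_second_tangent_set (epigraph UNIV g) (x, g x) (w, 0) \<noteq> {}"
  obtains m \<mu> where "0 < m" "\<mu> \<in> lagrange_multipliers g \<Phi> K x"
    "\<And>z r. (z, r) \<in> inner_second_tangent_set (epigraph UNIV g) (x, g x) (w, 0) \<Longrightarrow>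
      (- adjoint \<Phi> \<mu>) \<bullet> z + m \<le> r"
proof -
  let ?T = "inner_second_tangent_set (epigraph UNIV g) (x, g x) (w, 0)"
  obtain F where F: "finite F" "K = \<Inter> F" "\<forall>h\<in>F. \<exists>a b. a \<noteq> 0 \<and> h = {y. a \<bullet> y \<le> b}"
    using poly by (auto simp: polyhedron_def)
  then obtain a b where ab: "\<And>h. h \<in> F \<Longrightarrow> h = {y. a h \<bullet> y \<le> b h}" by metis
  have K: "y \<in> K \<longleftrightarrow> (\<forall>h\<in>F. a h \<bullet> y \<le> b h)" for y using F(2) ab by blast
  \<comment> \<open>Only constraints active at \<open>\<Phi> x\<close> and constant along
    \<open>\<Phi> w\<close> matter at second order; the others keep a slack of order 1 or
    \<open>t\<close>.\<close>
  define J where "J = a ` {h \<in> F. a h \<bullet> \<Phi> x = b h \<and> a h \<bullet> \<Phi> w = 0}"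
  \<comment> \<open>\<open>P\<close> is the preimage under \<open>\<Phi>\<close> of the tangent cone at \<open>\<Phi> w\<close> of the tangent cone of \<open>K\<close>.\<close>
  define P where "P = {z. \<forall>j\<in>J. j \<bullet> \<Phi> z \<le> 0}"
  have P0: "0 \<in> P" using lin by (simp add: P_def linear_0)
  have Pscale: "s *\<^sub>R z \<in> P" if "z \<in> P" "0 \<le> s" for s z
    using that lin by (auto simp: P_def linear_scale mult_le_0_iff)
  have Padd: "y + z \<in> P" if "y \<in> P" "z \<in> P" for y z
    using that lin by (force simp: P_def linear_add inner_add_right)
  have convP: "convex P" by (rule convexI) (auto intro: Padd Pscale)
  have normal: "a h \<in> normal_cone K (\<Phi> x)" if "h \<in> F" "a h \<bullet> \<Phi> x = b h" for h
    using that feas K by (auto simp: normal_cone_def inner_diff_right)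
  obtain \<epsilon> c where \<epsilon>: "0 < \<epsilon>" and c: "0 < c"
    and growth: "\<And>y. y \<in> cball x \<epsilon> \<Longrightarrow> \<Phi> y \<in> K \<Longrightarrow> c * (norm (y - x))\<^sup>2 \<le> g y - g x"
    using strong unfolding strong_solution_def by blast
  \<comment> \<open>To leading order, growth along the parabola reads
    \<open>c * norm (t w)^2 \<le> t^2 / 2 * r\<close>; solving for \<open>r\<close> gives this
    bound.\<close>
  define m where "m = 2 * c * (norm w)\<^sup>2"
  have m: "0 < m" using c w(2) by (simp add: m_def)
  have above: "m \<le> r" if z: "z \<in> P" and zr: "(z, r) \<in> ?T" for z r
  proof -
    obtain t where t: "decreases_to_0 t" using decreases_to_0_inverse_Suc by blast
    note tlim = decreases_to_0D(2)[OF t]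
    obtain u where u: "u \<longlonglongrightarrow> (z, r)"
      "\<And>k. (x, g x) + t k *\<^sub>R (w, 0) + (1/2 * (t k)\<^sup>2) *\<^sub>R u k \<in> epigraph UNIV g"
      using zr t by (auto simp: inner_second_tangent_set_def)
    \<comment> \<open>\<open>y\<close> uses the exact \<open>z\<close> and is eventually feasible;
      \<open>y'\<close> uses the approximating \<open>u\<close> and carries the epigraph bound. They
      differ by o(t^2), so a local Lipschitz bound compares the values of \<open>g\<close>.\<close>
    define y where "y k = x + t k *\<^sub>R w + (1/2 * (t k)\<^sup>2) *\<^sub>R z" for k
    define y' where "y' k = x + t k *\<^sub>R w + (1/2 * (t k)\<^sup>2) *\<^sub>R fst (u k)" for k
    have fst_u: "(\<lambda>k. fst (u k)) \<longlonglongrightarrow> z" and snd_u: "(\<lambda>k. snd (u k)) \<longlonglongrightarrow> r"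
      using tendsto_fst[OF u(1)] tendsto_snd[OF u(1)] by auto
    have "y \<longlonglongrightarrow> x + 0 *\<^sub>R w + (1/2 * 0\<^sup>2) *\<^sub>R z"
      unfolding y_def by (intro tendsto_intros tlim)
    then have y: "y \<longlonglongrightarrow> x" by simp
    have "y' \<longlonglongrightarrow> x + 0 *\<^sub>R w + (1/2 * 0\<^sup>2) *\<^sub>R z"
      unfolding y'_def by (intro tendsto_intros tlim fst_u)
    then have y': "y' \<longlonglongrightarrow> x" by simp
    have gy': "g (y' k) \<le> g x + 1/2 * (t k)\<^sup>2 * snd (u k)" for k
      using u(2)[of k] by (cases "u k") (simp add: mem_epigraph y'_def)
    obtain L where L: "\<And>y z. y \<in> cball x 1 \<Longrightarrow> z \<in> cball x 1 \<Longrightarrow> g y - g z \<le> L * norm (y - z)"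
      using convex_on_locally_lipschitz[OF conv cont] by blast
    have \<Phi>y: "\<Phi> (y k) = \<Phi> x + t k *\<^sub>R \<Phi> w + (1/2 * (t k)\<^sup>2) *\<^sub>R \<Phi> z" for k
      unfolding y_def using lin by (simp add: linear_add linear_scale)
    have "\<forall>\<^sub>F k in sequentially. a h \<bullet> \<Phi> (y k) \<le> b h" if h: "h \<in> F" for h
    proof (cases "a h \<bullet> \<Phi> x = b h")
      case False
      then have "a h \<bullet> \<Phi> x < b h" using K feas h by force
      moreover have "(\<lambda>k. a h \<bullet> \<Phi> (y k)) \<longlonglongrightarrow>
          a h \<bullet> (\<Phi> x + 0 *\<^sub>R \<Phi> w + (1/2 * 0\<^sup>2) *\<^sub>R \<Phi> z)"
        unfolding \<Phi>y by (intro tendsto_intros tlim)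
      then have "(\<lambda>k. a h \<bullet> \<Phi> (y k)) \<longlonglongrightarrow> a h \<bullet> \<Phi> x" by simp
      ultimately have "\<forall>\<^sub>F k in sequentially. a h \<bullet> \<Phi> (y k) < b h" by (rule order_tendstoD(2)[rotated])
      then show ?thesis by eventually_elim simp
    next
      case True
      have le: "a h \<bullet> \<Phi> w \<le> 0"
        using normal_cone_contingent_cone[OF normal[OF h True] w(1)] .
      have split: "a h \<bullet> \<Phi> (y k) = b h + t k * (a h \<bullet> \<Phi> w + 1/2 * t k * (a h \<bullet> \<Phi> z))" for k
        by (simp add: \<Phi>y inner_add_right True power2_eq_square algebra_simps)
      have "\<forall>\<^sub>F k in sequentially. a h \<bullet> \<Phi> w + 1/2 * t k * (a h \<bullet> \<Phi> z) \<le> 0"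
      proof (cases "a h \<bullet> \<Phi> w = 0")
        case eq: True
        then have "a h \<bullet> \<Phi> z \<le> 0" using z h True by (auto simp: P_def J_def)
        then show ?thesis using decreases_to_0D(1)[OF t]
          by (intro always_eventually) (auto simp: eq mult_le_0_iff less_imp_le)
      next
        case neq: False
        have "(\<lambda>k. a h \<bullet> \<Phi> w + 1/2 * t k * (a h \<bullet> \<Phi> z))
            \<longlonglongrightarrow> a h \<bullet> \<Phi> w + 1/2 * 0 * (a h \<bullet> \<Phi> z)"
          by (intro tendsto_intros tlim)
        then have "\<forall>\<^sub>F k in sequentially. a h \<bullet> \<Phi> w + 1/2 * t k * (a h \<bullet> \<Phi> z) < 0"
          by (rule order_tendstoD(2)) (use le neq in simp)
        then show ?thesis by eventually_elim simp
      qed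
      then show ?thesis
      proof eventually_elim
        case (elim k)
        then have "t k * (a h \<bullet> \<Phi> w + 1/2 * t k * (a h \<bullet> \<Phi> z)) \<le> 0"
          using decreases_to_0D(1)[OF t, of k] by (intro mult_nonneg_nonpos) auto
        then show ?case unfolding split by simp
      qed
    qed
    then have evK: "\<forall>\<^sub>F k in sequentially. \<Phi> (y k) \<in> K"
      unfolding K by (intro eventually_ball_finite F(1)) blast
    have ball: "\<forall>\<^sub>F k in sequentially. s k \<in> cball x e" if "s \<longlonglongrightarrow> x" "0 < e" for s e
      using tendstoD[OF that] by eventually_elim (simp add: dist_commute)
    \<comment> \<open>This is growth at \<open>y\<close> divided by half of \<open>(t k)^2\<close>;
      the sides converge to \<open>m\<close> and \<open>r\<close>.\<close>
    have le: "\<forall>\<^sub>F k in sequentially.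
        2 * c * (norm (w + (1/2 * t k) *\<^sub>R z))\<^sup>2 \<le> L * norm (z - fst (u k)) + snd (u k)"
      using evK ball[OF y \<epsilon>] ball[OF y, of 1, simplified] ball[OF y', of 1, simplified]
    proof eventually_elim
      case (elim k)
      have tk: "0 < t k" by (rule decreases_to_0D(1)[OF t])
      have "y k - x = t k *\<^sub>R (w + (1/2 * t k) *\<^sub>R z)"
        by (simp add: y_def scaleR_add_right power2_eq_square)
      then have "c * ((t k)\<^sup>2 * (norm (w + (1/2 * t k) *\<^sub>R z))\<^sup>2) \<le> g (y k) - g x"
        using growth[OF elim(2,1)] by (simp add: power_mult_distrib)
      also have "\<dots> \<le> L * norm (y k - y' k) + 1/2 * (t k)\<^sup>2 * snd (u k)"
        using L[of "y k" "y' k"] elim gy'[of k] by simp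
      also have "y k - y' k = (1/2 * (t k)\<^sup>2) *\<^sub>R (z - fst (u k))"
        by (simp add: y_def y'_def scaleR_diff_right)
      also have "norm \<dots> = 1/2 * (t k)\<^sup>2 * norm (z - fst (u k))" by simp
      finally have "(t k)\<^sup>2 * (2 * c * (norm (w + (1/2 * t k) *\<^sub>R z))\<^sup>2)
          \<le> (t k)\<^sup>2 * (L * norm (z - fst (u k)) + snd (u k))"
        by (simp add: algebra_simps)
      then show ?case using tk by (simp add: mult_le_cancel_left_pos)
    qed
    have lower: "(\<lambda>k. 2 * c * (norm (w + (1/2 * t k) *\<^sub>R z))\<^sup>2)
        \<longlonglongrightarrow> 2 * c * (norm (w + (1/2 * 0) *\<^sub>R z))\<^sup>2"
      by (intro tendsto_intros tlim)
    have upper: "(\<lambda>k. L * norm (z - fst (u k)) + snd (u k)) \<longlonglongrightarrow> L * norm (z - z) + r"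
      by (intro tendsto_intros fst_u snd_u)
    from tendsto_le[OF sequentially_bot upper lower le] show ?thesis by (simp add: m_def)
  qed
  have convE: "convex (epigraph UNIV g)" using conv by (rule convex_epigraphI)
  obtain z0 r0 where z0: "(z0, r0) \<in> ?T" using ne by auto
  have recession: "(z0 + s *\<^sub>R d, r0 + s * (g (x + d) - g x)) \<in> ?T" if "0 \<le> s" for s d
    using inner_second_tangent_set_recession[OF convE _ that z0, of "(d, g (x + d) - g x)"]
    by (simp add: mem_epigraph)
  have "z \<in> fst ` ?T" for z using recession[of 1 "z - z0"] by force
  then have proj: "fst ` ?T = UNIV" by blast
  obtain v \<beta> where v: "\<And>z r. (z, r) \<in> ?T \<Longrightarrow> v \<bullet> z + \<beta> \<le> r"
    and vP: "\<And>z. z \<in> P \<Longrightarrow> m \<le> v \<bullet> z + \<beta>"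
  proof (rule convex_minorant_separation[where E = ?T and P = P and m = m])
    show "convex ?T" by (rule convex_inner_second_tangent_set[OF convE])
    show "P \<noteq> {}" using P0 by blast
  qed (use proj convP above in \<open>blast+\<close>)
  have \<beta>: "m \<le> \<beta>" using vP[OF P0] by simp
  have "(- v) \<bullet> z \<le> 0" if "\<And>j. j \<in> J \<Longrightarrow> j \<bullet> \<Phi> z \<le> 0" for z
  proof (rule ccontr)
    assume "\<not> ?thesis"
    then have neg: "v \<bullet> z < 0" by simp
    have "z \<in> P" using that by (simp add: P_def)
    \<comment> \<open>With this factor the minorant takes the value \<open>m - 1\<close> at a point
      of \<open>P\<close>.\<close>
    then have "((m - \<beta> - 1) / (v \<bullet> z)) *\<^sub>R z \<in> P"
      using neg \<beta> by (intro Pscale) (auto intro: divide_nonpos_neg)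
    from vP[OF this] neg show False by simp
  qed
  moreover have "finite J" using F(1) by (simp add: J_def)
  ultimately obtain \<mu> where \<mu>: "\<mu> \<in> convex_cone hull J" "- v = adjoint \<Phi> \<mu>"
    using adjoint_farkas[OF lin, of J "- v"] by blast
  have v_eq: "- adjoint \<Phi> \<mu> = v" using \<mu>(2) by (metis minus_minus)
  have "convex_cone (normal_cone K (\<Phi> x))"
    using feas by (auto simp: convex_cone_iff normal_cone_def inner_add_left
        intro: add_nonpos_nonpos mult_nonneg_nonpos)
  then have "convex_cone hull J \<subseteq> normal_cone K (\<Phi> x)"
    by (intro hull_minimal) (auto simp: J_def intro: normal)
  \<comment> \<open>The affine minorant on \<open>?T\<close> passes to its recession directions, which include the
    translated epigraph.\<close>
  moreover have "v \<in> subdifferential (\<lambda>y. ereal (g y)) x"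
    unfolding mem_subdifferential_ereal
  proof (intro allI, rule ccontr)
    fix y assume "\<not> g x + v \<bullet> (y - x) \<le> g y"
    then have gap: "0 < v \<bullet> (y - x) - (g y - g x)" (is "0 < ?q") by simp
    have le: "v \<bullet> z0 + s * ?q + \<beta> \<le> r0" if "0 \<le> s" for s
      using v[OF recession[OF that, of "y - x"]] by (simp add: algebra_simps)
    \<comment> \<open>This choice makes the left side of \<open>le\<close> equal to
      \<open>r0 + 1\<close>.\<close>
    let ?s = "(r0 - \<beta> - v \<bullet> z0 + 1) / ?q"
    have "0 \<le> ?s" using le[of 0] gap by simp
    from le[OF this] gap show False by simp
  qed
  ultimately have "\<mu> \<in> lagrange_multipliers g \<Phi> K x"
    using \<mu>(1) by (auto simp: lagrange_multipliers_def v_eq)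
  moreover have "v \<bullet> z + m \<le> r" if "(z, r) \<in> ?T" for z r using v[OF that] \<beta> by simp
  ultimately show thesis using that m v_eq by blast
qed

lemma strong_solution_imp_trivial:
  fixes g :: "'a::euclidean_space \<Rightarrow> real" and \<Phi> :: "'a \<Rightarrow> 'b::euclidean_space"
  assumes cont: "continuous_on UNIV g" and conv: "convex_on UNIV g"
    and lin: "linear \<Phi>" and poly: "polyhedron K" and stat: "stationary_point g \<Phi> K x"
    and reg: "second_order_regular g x" and strong: "strong_solution g \<Phi> K x"
    and crit: "w \<in> critical_cone g \<Phi> K x"
    and tang: "\<And>\<mu>. \<mu> \<in> lagrange_multipliers g \<Phi> K x \<Longrightarrow>
      w \<in> contingent_cone (subdifferential (fenchel_conjugate g) (- adjoint \<Phi> \<mu>)) x"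
  shows "w = 0"
proof (rule ccontr)
  assume "w \<noteq> 0"
  let ?E = "epigraph UNIV g" and ?X = "(x, g x)" and ?W = "(w, 0::real)"
  let ?T = "outer_second_tangent_set ?E ?X ?W"
  have \<Phi>w: "\<Phi> w \<in> contingent_cone K (\<Phi> x)" and dw: "subderivative g x w = 0"
    using crit by (auto simp: critical_cone_def)
  \<comment> \<open>Tangency is lifted to the epigraph: on the sublevel set \<open>g\<close> is at
    most the affine function of slope \<open>v\<close> through \<open>(x, g x)\<close>, so
    directions \<open>p k\<close> get height \<open>v \<bullet> p k\<close>. Criticality gives
    \<open>v \<bullet> w = 0\<close>, hence the limit \<open>(w, 0)\<close>.\<close>
  have seq: "\<exists>t u. decreases_to_0 t \<and> u \<longlonglongrightarrow> ?W \<and> (\<forall>k. ?X + t k *\<^sub>R u k \<in> ?E)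
      \<and> (\<forall>k. snd (u k) = (- adjoint \<Phi> \<mu>) \<bullet> fst (u k)) \<and> (- adjoint \<Phi> \<mu>) \<bullet> w = 0"
    if \<mu>: "\<mu> \<in> lagrange_multipliers g \<Phi> K x" for \<mu>
  proof -
    define v where "v = - adjoint \<Phi> \<mu>"
    have v: "v \<in> subdifferential (\<lambda>y. ereal (g y)) x"
      using \<mu> by (simp add: lagrange_multipliers_def v_def)
    have "0 \<le> v \<bullet> w" using multiplier_contingent_nonneg[OF lin \<mu> \<Phi>w] by (simp add: v_def)
    moreover have "v \<bullet> w \<le> 0" using subderivative_ge_subgradient[OF v, of w] dw by simp
    ultimately have vw: "v \<bullet> w = 0" by simp
    obtain t p where t: "decreases_to_0 t" and p: "p \<longlonglongrightarrow> w"
      and S: "\<And>k. x + t k *\<^sub>R p k \<in> {z. g z - v \<bullet> z \<le> g x - v \<bullet> x}"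
      using tang[OF \<mu>] unfolding v_def[symmetric] subdifferential_fenchel_conjugate[OF conv v]
      by (auto simp: contingent_cone_def)
    have "(\<lambda>k. (p k, v \<bullet> p k)) \<longlonglongrightarrow> (w, v \<bullet> w)" by (intro tendsto_intros p)
    moreover have "?X + t k *\<^sub>R (p k, v \<bullet> p k) \<in> ?E" for k
      using S[of k] by (simp add: mem_epigraph inner_add_right)
    ultimately show ?thesis
      using t vw unfolding v_def[symmetric] by (intro exI[of _ t] exI[of _ "\<lambda>k. (p k, v \<bullet> p k)"]) simp
  qed
  \<comment> \<open>Rescaling the deviation \<open>u k - ?W\<close> by \<open>2 / t k\<close> writes
    the points in parabola form. Here \<open>r\<close> may be unbounded, but \<open>t k\<close>
    times \<open>r k\<close> tends to 0, which is what regularity asks for.\<close>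
  have near: "\<exists>r. (\<lambda>k::nat. ext_infdist (r k) ?T) \<longlonglongrightarrow> 0
      \<and> (\<forall>k. snd (r k) = (- adjoint \<Phi> \<mu>) \<bullet> fst (r k)) \<and> ?T = inner_second_tangent_set ?E ?X ?W"
    if \<mu>: "\<mu> \<in> lagrange_multipliers g \<Phi> K x" for \<mu>
  proof -
    obtain t u where t: "decreases_to_0 t" and u: "u \<longlonglongrightarrow> ?W" and E: "\<And>k. ?X + t k *\<^sub>R u k \<in> ?E"
      and snd_u: "\<And>k. snd (u k) = (- adjoint \<Phi> \<mu>) \<bullet> fst (u k)" and vw: "(- adjoint \<Phi> \<mu>) \<bullet> w = 0"
      using seq[OF \<mu>] by blast
    define r where "r k = (2 / t k) *\<^sub>R (u k - ?W)" for k
    have t0: "t k \<noteq> 0" for k using decreases_to_0D(1)[OF t, of k] by simp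
    have "(\<lambda>k. 2 *\<^sub>R (u k - ?W)) \<longlonglongrightarrow> 2 *\<^sub>R (?W - ?W)" by (intro tendsto_intros u)
    then have "(\<lambda>k. t k *\<^sub>R r k) \<longlonglongrightarrow> 0" using t0 by (simp add: r_def)
    moreover have "?X + t k *\<^sub>R ?W + (1/2 * (t k)\<^sup>2) *\<^sub>R r k \<in> ?E" for k
    proof -
      have r: "(1/2 * (t k)\<^sup>2) *\<^sub>R r k = t k *\<^sub>R (u k - ?W)"
        using t0 by (simp add: r_def power2_eq_square)
      have "p + s *\<^sub>R q + s *\<^sub>R (d - q) = p + s *\<^sub>R d" for p q d :: "'a \<times> real" and s
        by (simp add: scaleR_diff_right)
      from this[of ?X "t k" ?W "u k"] E[of k] show ?thesis unfolding r by (rule ssubst)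
    qed
    moreover have "?W \<in> contingent_cone ?E ?X"
      using t u E by (auto simp: contingent_cone_def)
    ultimately have "(\<lambda>k. ext_infdist (r k) ?T) \<longlonglongrightarrow> 0" "?T = inner_second_tangent_set ?E ?X ?W"
      using reg t unfolding second_order_regular_def second_order_regular_set_def by blast+
    moreover have "snd (r k) = (- adjoint \<Phi> \<mu>) \<bullet> fst (r k)" for k
      using vw by (simp add: r_def snd_u inner_diff_right)
    ultimately show ?thesis by blast
  qed
  obtain \<mu>0 where "\<mu>0 \<in> lagrange_multipliers g \<Phi> K x" and feas: "\<Phi> x \<in> K"
    using stat by (auto simp: stationary_point_def)
  from near[OF this(1)] obtain r0 where r0: "(\<lambda>k::nat. ext_infdist (r0 k) ?T) \<longlonglongrightarrow> 0"
    and T: "?T = inner_second_tangent_set ?E ?X ?W" by blast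
  \<comment> \<open>The distance to the empty set is infinite, so it cannot tend to 0.\<close>
  have "?T \<noteq> {}"
  proof
    assume "?T = {}"
    then have "(\<lambda>k::nat. \<infinity>::ereal) \<longlonglongrightarrow> 0" using r0 by (simp add: ext_infdist_def top_ereal_def)
    then show False by (simp add: LIMSEQ_const_iff)
  qed
  then have "inner_second_tangent_set ?E ?X ?W \<noteq> {}" unfolding T .
  with cont conv lin poly feas strong \<Phi>w \<open>w \<noteq> 0\<close> show False
  proof (rule second_tangent_multiplier)
    fix \<mu> m
    assume m: "0 < m" and \<mu>: "\<mu> \<in> lagrange_multipliers g \<Phi> K x"
      and "\<And>z \<rho>. (z, \<rho>) \<in> inner_second_tangent_set ?E ?X ?W \<Longrightarrow> (- adjoint \<Phi> \<mu>) \<bullet> z + m \<le> \<rho>"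
    then have le: "\<And>z \<rho>. (z, \<rho>) \<in> ?T \<Longrightarrow> (- adjoint \<Phi> \<mu>) \<bullet> z + m \<le> \<rho>"
      unfolding T by blast
    define v where "v = - adjoint \<Phi> \<mu>"
    \<comment> \<open>\<open>near\<close> was shown for every multiplier, so it applies to the one
      obtained from the growth.\<close>
    obtain r where r: "(\<lambda>k::nat. ext_infdist (r k) ?T) \<longlonglongrightarrow> 0" and snd_r: "\<And>k. snd (r k) = v \<bullet> fst (r k)"
      using near[OF \<mu>] v_def by blast
    \<comment> \<open>\<open>?T\<close> lies at least \<open>m\<close> above the graph of slope
      \<open>v\<close>; a vertical gap \<open>m\<close> means a distance of at least
      \<open>m / (1 + norm v)\<close>.\<close>
    define \<delta> where "\<delta> = m / (1 + norm v)"
    have n: "0 < 1 + norm v" by (simp add: add_pos_nonneg)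
    have "\<delta> \<le> dist (r k) q" if q: "q \<in> ?T" for k q
    proof -
      obtain z \<rho> where z: "q = (z, \<rho>)" by (cases q)
      have "m \<le> (\<rho> - snd (r k)) - v \<bullet> (z - fst (r k))"
        using le[of z \<rho>] q z snd_r[of k] by (simp add: v_def inner_diff_right)
      also have "\<dots> \<le> dist (snd q) (snd (r k)) + norm v * dist (fst q) (fst (r k))"
        using Cauchy_Schwarz_ineq2[of v "z - fst (r k)"] z by (auto simp: dist_norm)
      also have "\<dots> \<le> dist q (r k) + norm v * dist q (r k)"
        by (intro add_mono mult_left_mono dist_snd_le dist_fst_le) auto
      finally show ?thesis using n by (simp add: \<delta>_def pos_divide_le_eq algebra_simps dist_commute)
    qed
    then have "ereal \<delta> \<le> ext_infdist (r k) ?T" for k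
      unfolding ext_infdist_def by (intro INF_greatest) simp
    then have "ereal \<delta> \<le> 0" using r by (intro LIMSEQ_le_const) auto
    moreover have "0 < \<delta>" using m n by (simp add: \<delta>_def)
    ultimately show False by simp
  qed
qed

section \<open>Sufficiency of the tangent cone condition\<close>

text \<open>Radius and growth constant are both taken as \<open>1 / (n + 1)\<close>. The distances
  of the violating points to \<open>x\<close> serve as \<open>t\<close>, and compactness of the unit
  sphere yields a limit direction.\<close>

lemma not_strong_solution_sequence:
  fixes g :: "'a::euclidean_space \<Rightarrow> real"
  assumes "\<not> strong_solution g \<Phi> K x"
  shows "\<exists>t u w c. decreases_to_0 t \<and> u \<longlonglongrightarrow> w \<and> w \<noteq> 0 \<and> c \<longlonglongrightarrow> 0 \<and>
    (\<forall>k. \<Phi> (x + t k *\<^sub>R u k) \<in> K) \<and> (\<forall>k. g (x + t k *\<^sub>R u k) - g x \<le> c k * (t k)\<^sup>2)"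
proof -
  define e :: "nat \<Rightarrow> real" where "e n = inverse (real (Suc n))" for n
  have e: "0 < e n" for n by (simp add: e_def)
  have elim: "e \<longlonglongrightarrow> 0" unfolding e_def by (rule LIMSEQ_inverse_real_of_nat)
  have "\<exists>y. y \<in> cball x (e n) \<and> \<Phi> y \<in> K \<and> g y - g x < e n * (norm (y - x))\<^sup>2" for n
  proof (rule ccontr)
    assume "\<not> ?thesis"
    then have "\<forall>y\<in>cball x (e n). \<Phi> y \<in> K \<longrightarrow> g y - g x \<ge> e n * (norm (y - x))\<^sup>2"
      by (metis not_less)
    with e[of n] assms show False unfolding strong_solution_def by blast
  qed
  then obtain y where y: "\<And>n. y n \<in> cball x (e n)" "\<And>n. \<Phi> (y n) \<in> K"
    "\<And>n. g (y n) - g x < e n * (norm (y n - x))\<^sup>2" by metis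
  \<comment> \<open>The strict violation rules out \<open>x\<close> itself, so displacements can be
    normalised.\<close>
  have ne: "y n \<noteq> x" for n
  proof
    assume "y n = x"
    with y(3)[of n] show False by simp
  qed
  define s where "s n = norm (y n - x)" for n
  define p where "p n = (y n - x) /\<^sub>R s n" for n
  have s: "0 < s n" for n using ne by (simp add: s_def)
  have "p n \<in> sphere 0 1" for n using s[of n] by (simp add: p_def s_def)
  then obtain w \<sigma> where w: "w \<in> sphere 0 1" and \<sigma>: "strict_mono \<sigma>" and lim: "(p \<circ> \<sigma>) \<longlonglongrightarrow> w"
    using compact_sphere[of "0::'a" 1] unfolding compact_def by blast
  have "s \<longlonglongrightarrow> 0"
  proof (rule tendsto_sandwich[OF _ _ tendsto_const elim])
    show "\<forall>\<^sub>F n in sequentially. s n \<le> e n"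
      using y(1) by (intro always_eventually) (auto simp: s_def dist_norm norm_minus_commute)
  qed (simp add: s_def)
  then have t: "decreases_to_0 (s \<circ> \<sigma>)"
    using s LIMSEQ_subseq_LIMSEQ[OF _ \<sigma>] by (auto simp: decreases_to_0_def)
  have c: "(e \<circ> \<sigma>) \<longlonglongrightarrow> 0" using elim \<sigma> by (rule LIMSEQ_subseq_LIMSEQ)
  have "x + s n *\<^sub>R p n = y n" for n using s[of n] by (simp add: p_def)
  then have y': "\<Phi> (x + (s \<circ> \<sigma>) k *\<^sub>R (p \<circ> \<sigma>) k) \<in> K"
    "g (x + (s \<circ> \<sigma>) k *\<^sub>R (p \<circ> \<sigma>) k) - g x \<le> (e \<circ> \<sigma>) k * ((s \<circ> \<sigma>) k)\<^sup>2" for k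
    using y(2,3)[of "\<sigma> k"] by (simp_all add: s_def)
  have "w \<noteq> 0" using w by auto
  then show ?thesis
    using t lim c y'
    by (intro exI[of _ "s \<circ> \<sigma>"] exI[of _ "p \<circ> \<sigma>"] exI[of _ w] exI[of _ "e \<circ> \<sigma>"]) blast
qed

text \<open>A gap of o(t^2) puts the points within o(t) of the sublevel set, so projecting them onto
  it preserves the limit direction.\<close>

lemma quadratic_growth_contingent:
  fixes g :: "'a::euclidean_space \<Rightarrow> real"
  assumes cont: "continuous_on UNIV g" and qg: "quadratic_growth g x"
    and v: "v \<in> subdifferential (\<lambda>y. ereal (g y)) x"
    and t: "decreases_to_0 t" and u: "u \<longlonglongrightarrow> w" and c: "c \<longlonglongrightarrow> 0"
    and gap: "\<And>k. g (x + t k *\<^sub>R u k) - g x - v \<bullet> (t k *\<^sub>R u k) \<le> c k * (t k)\<^sup>2"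
  shows "w \<in> contingent_cone {z. g z - v \<bullet> z \<le> g x - v \<bullet> x} x"
proof -
  let ?S = "{z. g z - v \<bullet> z \<le> g x - v \<bullet> x}"
  obtain \<epsilon> \<delta> \<kappa> where pos: "0 < \<epsilon>" "0 < \<delta>" "0 < \<kappa>"
    and growth: "\<And>y. y \<in> cball x \<epsilon> \<Longrightarrow> g y - g x - v \<bullet> (y - x) < \<delta> \<Longrightarrow>
      \<kappa> / 2 * (infdist y ?S)\<^sup>2 \<le> g y - g x - v \<bullet> (y - x)"
    using qg v unfolding quadratic_growth_def by blast
  define q where "q = closest_point ?S"
  have "closed ?S" by (intro closed_Collect_le continuous_intros cont)
  moreover have "?S \<noteq> {}" by blast
  ultimately have q: "q y \<in> ?S" "infdist y ?S = dist y (q y)" for y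
    unfolding q_def by (rule closest_point_in_set, simp add: infdist_eq_setdist setdist_closest_point)
  define y where "y k = x + t k *\<^sub>R u k" for k
  have tpos: "0 < t k" for k by (rule decreases_to_0D(1)[OF t])
  note tlim = decreases_to_0D(2)[OF t]
  have "y \<longlonglongrightarrow> x + 0 *\<^sub>R w" unfolding y_def by (intro tendsto_intros tlim u)
  then have "\<forall>\<^sub>F k in sequentially. dist (y k) x < \<epsilon>" using tendstoD[OF _ pos(1)] by simp
  moreover have "(\<lambda>k. c k * (t k)\<^sup>2) \<longlonglongrightarrow> 0 * 0\<^sup>2" by (intro tendsto_intros tlim c)
  then have "\<forall>\<^sub>F k in sequentially. c k * (t k)\<^sup>2 < \<delta>" using pos by (intro order_tendstoD) simp_all
  ultimately have ev: "\<forall>\<^sub>F k in sequentially. norm ((q (y k) - y k) /\<^sub>R t k) \<le> sqrt (2 / \<kappa> * c k)"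
  proof eventually_elim
    case (elim k)
    have gapk: "g (y k) - g x - v \<bullet> (y k - x) \<le> c k * (t k)\<^sup>2" using gap[of k] by (simp add: y_def)
    then have "\<kappa> / 2 * (dist (y k) (q (y k)))\<^sup>2 \<le> c k * (t k)\<^sup>2"
      using growth[of "y k"] elim q(2)[of "y k"] by (simp add: dist_commute)
    then have "(dist (y k) (q (y k)) / t k)\<^sup>2 \<le> 2 / \<kappa> * c k"
      using tpos[of k] pos by (simp add: power_divide field_simps)
    moreover have "norm ((q (y k) - y k) /\<^sub>R t k) = dist (y k) (q (y k)) / t k"
      using tpos[of k] by (simp add: dist_norm norm_minus_commute divide_inverse)
    ultimately show ?case by (metis real_le_rsqrt)
  qed
  have "(\<lambda>k. sqrt (2 / \<kappa> * c k)) \<longlonglongrightarrow> sqrt (2 / \<kappa> * 0)" by (intro tendsto_intros c)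
  then have "(\<lambda>k. sqrt (2 / \<kappa> * c k)) \<longlonglongrightarrow> 0" by simp
  then have "(\<lambda>k. (q (y k) - y k) /\<^sub>R t k) \<longlonglongrightarrow> 0" by (rule Lim_null_comparison[OF ev])
  \<comment> \<open>The corrected directions lead from \<open>x\<close> exactly to the
    projections.\<close>
  then have "(\<lambda>k. u k + (q (y k) - y k) /\<^sub>R t k) \<longlonglongrightarrow> w + 0" by (intro tendsto_add u)
  moreover have "x + t k *\<^sub>R (u k + (q (y k) - y k) /\<^sub>R t k) = q (y k)" for k
    using tpos[of k] by (simp add: scaleR_add_right y_def)
  ultimately show ?thesis
    using t q(1) unfolding contingent_cone_def
    by (intro CollectI exI[of _ t] exI[of _ "\<lambda>k. u k + (q (y k) - y k) /\<^sub>R t k"]) simp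
qed

text \<open>The sequence is fixed before any multiplier, so one \<open>w\<close> serves them all.
  Feasibility makes the linear term of each multiplier nonnegative, and subtracting it keeps the gap
  o(t^2).\<close>

lemma not_strong_solution_imp_nontrivial:
  fixes g :: "'a::euclidean_space \<Rightarrow> real" and \<Phi> :: "'a \<Rightarrow> 'b::euclidean_space"
  assumes cont: "continuous_on UNIV g" and conv: "convex_on UNIV g"
    and lin: "linear \<Phi>" and stat: "stationary_point g \<Phi> K x"
    and qg: "quadratic_growth g x" and "\<not> strong_solution g \<Phi> K x"
  shows "\<exists>w. w \<noteq> 0 \<and> w \<in> critical_cone g \<Phi> K x \<and> (\<forall>\<mu>\<in>lagrange_multipliers g \<Phi> K x.
      w \<in> contingent_cone (subdifferential (fenchel_conjugate g) (- adjoint \<Phi> \<mu>)) x)"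
proof -
  obtain t u w c where t: "decreases_to_0 t" and u: "u \<longlonglongrightarrow> w" and w: "w \<noteq> 0" and c: "c \<longlonglongrightarrow> 0"
    and K: "\<forall>k. \<Phi> (x + t k *\<^sub>R u k) \<in> K"
    and le: "\<forall>k. g (x + t k *\<^sub>R u k) - g x \<le> c k * (t k)\<^sup>2"
    using not_strong_solution_sequence[OF assms(6)] by blast
  have \<Phi>eq: "\<Phi> (x + t k *\<^sub>R u k) = \<Phi> x + t k *\<^sub>R \<Phi> (u k)" for k
    using lin by (simp add: linear_add linear_scale)
  have "(\<lambda>k. \<Phi> (u k)) \<longlonglongrightarrow> \<Phi> w"
    using lin u by (simp add: bounded_linear.tendsto linear_conv_bounded_linear)
  moreover have "\<forall>k. \<Phi> x + t k *\<^sub>R \<Phi> (u k) \<in> K" using K by (simp add: \<Phi>eq)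
  ultimately have \<Phi>w: "\<Phi> w \<in> contingent_cone K (\<Phi> x)"
    using t unfolding contingent_cone_def
    by (intro CollectI exI[of _ t] exI[of _ "\<lambda>k. \<Phi> (u k)"] conjI)
  note tlim = decreases_to_0D(2)[OF t]
  \<comment> \<open>Failure of growth bounds the quotients by \<open>c k * t k\<close>; the opposite
    bound comes from a multiplier.\<close>
  have "subderivative g x w \<le> ereal 0"
  proof (rule subderivative_le_sequence[OF t u])
    show "(g (x + t k *\<^sub>R u k) - g x) / t k \<le> c k * t k" for k
      using le[rule_format, of k] decreases_to_0D(1)[OF t, of k] by (simp add: field_simps power2_eq_square)
    show "(\<lambda>k. c k * t k) \<longlonglongrightarrow> 0" using tendsto_mult[OF c tlim] by simp
  qed
  moreover have subgrad: "- adjoint \<Phi> \<mu> \<in> subdifferential (\<lambda>y. ereal (g y)) x"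
    if "\<mu> \<in> lagrange_multipliers g \<Phi> K x" for \<mu>
    using that by (simp add: lagrange_multipliers_def)
  obtain \<mu>0 where \<mu>0: "\<mu>0 \<in> lagrange_multipliers g \<Phi> K x"
    using stat by (auto simp: stationary_point_def)
  have "0 \<le> subderivative g x w"
    using subderivative_ge_subgradient[OF subgrad[OF \<mu>0], of w]
      multiplier_contingent_nonneg[OF lin \<mu>0 \<Phi>w] by (meson ereal_less_eq(5) order.trans)
  ultimately have "w \<in> critical_cone g \<Phi> K x"
    using \<Phi>w by (simp add: critical_cone_def zero_ereal_def)
  moreover have "w \<in> contingent_cone (subdifferential (fenchel_conjugate g) (- adjoint \<Phi> \<mu>)) x"
    if \<mu>: "\<mu> \<in> lagrange_multipliers g \<Phi> K x" for \<mu>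
    unfolding subdifferential_fenchel_conjugate[OF conv subgrad[OF \<mu>]]
  proof (rule quadratic_growth_contingent[OF cont qg subgrad[OF \<mu>] t u c])
    fix k
    have "\<mu> \<bullet> (\<Phi> (x + t k *\<^sub>R u k) - \<Phi> x) \<le> 0"
      using \<mu> K unfolding lagrange_multipliers_def normal_cone_def by blast
    then have "0 \<le> (- adjoint \<Phi> \<mu>) \<bullet> (t k *\<^sub>R u k)"
      using lin by (simp add: \<Phi>eq adjoint_works inner_commute)
    then show "g (x + t k *\<^sub>R u k) - g x - (- adjoint \<Phi> \<mu>) \<bullet> (t k *\<^sub>R u k) \<le> c k * (t k)\<^sup>2"
      using le[rule_format, of k] by linarith
  qed
  ultimately show ?thesis using w by (intro exI[of _ w]) blast
qed

section \<open>The zero direction and the equivalence\<close>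

lemma zero_in_contingent_cone: "x \<in> \<Omega> \<Longrightarrow> 0 \<in> contingent_cone \<Omega> x"
  unfolding contingent_cone_def
  using decreases_to_0_inverse_Suc by (intro CollectI exI[of _ "\<lambda>_. 0"] exI) auto

text \<open>The condition is an equality with \<open>{0}\<close>, so 0 has to be a member. Its
  subderivative is bounded below by a subgradient from stationarity and above by the constant
  sequence.\<close>

lemma zero_in_critical_cone:
  fixes g :: "'a::euclidean_space \<Rightarrow> real" and \<Phi> :: "'a \<Rightarrow> 'b::euclidean_space"
  assumes lin: "linear \<Phi>" and stat: "stationary_point g \<Phi> K x"
  shows "0 \<in> critical_cone g \<Phi> K x"
proof -
  obtain \<mu> where "- adjoint \<Phi> \<mu> \<in> subdifferential (\<lambda>y. ereal (g y)) x"
    using stat by (auto simp: stationary_point_def lagrange_multipliers_def)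
  from subderivative_ge_subgradient[OF this, of 0] have "0 \<le> subderivative g x 0"
    by (simp add: zero_ereal_def)
  moreover have "subderivative g x 0 \<le> ereal 0"
    by (rule subderivative_le_sequence[OF decreases_to_0_inverse_Suc, of "\<lambda>_. 0" _ _ _ "\<lambda>_. 0"]) auto
  moreover have "\<Phi> 0 \<in> contingent_cone K (\<Phi> x)"
    using lin stat by (simp add: linear_0 stationary_point_def zero_in_contingent_cone)
  ultimately show ?thesis by (simp add: critical_cone_def zero_ereal_def)
qed

theorem theorem3p5:
  fixes g :: "'a::euclidean_space \<Rightarrow> real"
    and \<Phi> :: "'a \<Rightarrow> 'b::euclidean_space"
    and K :: "'b set"
    and x\<^sub>0 :: 'a
  assumes "continuous_on UNIV g"
    and "convex_on UNIV g"
    and "linear \<Phi>"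
    and "polyhedron K"
    and "stationary_point g \<Phi> K x\<^sub>0"
    and "second_order_regular g x\<^sub>0"
    and "quadratic_growth g x\<^sub>0"
  shows "strong_solution g \<Phi> K x\<^sub>0 \<longleftrightarrow>
    (\<Inter>\<mu>\<in>lagrange_multipliers g \<Phi> K x\<^sub>0.
        contingent_cone (subdifferential (fenchel_conjugate g) (- adjoint \<Phi> \<mu>)) x\<^sub>0)
      \<inter> critical_cone g \<Phi> K x\<^sub>0 = {0}"
proof -
  let ?D = "\<Inter>\<mu>\<in>lagrange_multipliers g \<Phi> K x\<^sub>0.
      contingent_cone (subdifferential (fenchel_conjugate g) (- adjoint \<Phi> \<mu>)) x\<^sub>0"
  have "0 \<in> ?D"
  proof
    fix \<mu> assume "\<mu> \<in> lagrange_multipliers g \<Phi> K x\<^sub>0"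
    then have "- adjoint \<Phi> \<mu> \<in> subdifferential (\<lambda>y. ereal (g y)) x\<^sub>0"
      by (simp add: lagrange_multipliers_def)
    from subdifferential_fenchel_conjugate[OF assms(2) this]
    show "0 \<in> contingent_cone (subdifferential (fenchel_conjugate g) (- adjoint \<Phi> \<mu>)) x\<^sub>0"
      by (simp add: zero_in_contingent_cone)
  qed
  then have zero: "0 \<in> ?D \<inter> critical_cone g \<Phi> K x\<^sub>0"
    using zero_in_critical_cone[OF assms(3,5)] by blast
  show ?thesis
  proof
    assume "strong_solution g \<Phi> K x\<^sub>0"
    from strong_solution_imp_trivial[OF assms(1-6) this] zero
    show "?D \<inter> critical_cone g \<Phi> K x\<^sub>0 = {0}" by blast
  next
    assume trivial: "?D \<inter> critical_cone g \<Phi> K x\<^sub>0 = {0}"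
    show "strong_solution g \<Phi> K x\<^sub>0"
    proof (rule ccontr)
      assume "\<not> strong_solution g \<Phi> K x\<^sub>0"
      from not_strong_solution_imp_nontrivial[OF assms(1-3,5,7) this]
      obtain w where "w \<noteq> 0" "w \<in> ?D \<inter> critical_cone g \<Phi> K x\<^sub>0" by blast
      then show False using trivial by simp
    qed
  qed
qed

end
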